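(* Let $R\subseteq S$ be as in the context. Let $n=n_1+\cdots+n_\ell$ and $N=N_1+\cdots+N_\ell$ with positive integers $n_i,N_i$, let $\mathcal{C}\subseteq S^n$ be a code, and let $A={\rm Diag}(A_1,\ldots,A_\ell)\in R^{n\times N}$ with $A_i\in R^{n_i\times N_i}$. Let $\rho=n-{\rm frk}(A)$ and let $t\ge 0$ be an integer. If $2t+\rho+1\le{\rm d}_{SR}(\mathcal{C})$ (sum-rank distance for the partition $n=n_1+\cdots+n_\ell$), then there exists a map $D_A:S^N\to\mathcal{C}$ with $D_A(\mathbf{c}A+\mathbf{e})=\mathbf{c}$ for all $\mathbf{c}\in\mathcal{C}$ and all $\mathbf{e}\in S^N$ with ${\rm wt}_{SR}(\mathbf{e})\le t$ (sum-rank weight for the partition $N=N_1+\cdots+N_\ell$).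
   Context: $R$ is a finite commutative chain ring with maximal ideal $\mathfrak{m}$; $S=R[x]/(h)$ with $h\in R[x]$ monic of degree $m$ irreducible modulo $\mathfrak{m}$, a free $R$-module of rank $m$; vectors in $S^n$ are multiplied by matrices over $R\subseteq S$ in the usual way. For a matrix $B$ over $R$ with Smith normal form diagonal $d_1,\ldots,d_r$, ${\rm rk}(B)$ is the number of nonzero $d_i$ and the free rank ${\rm frk}(B)$ is the number of $d_i$ that are units. For $\mathbf{u}\in S^s$, ${\rm rk}(\mathbf{u})$ is the rank of the $m\times s$ coordinate matrix of $\mathbf{u}$ over $R$ with respect to an $R$-basis of $S$. For $\mathbf{c}=(\mathbf{c}^{(1)},\ldots,\mathbf{c}^{(\ell)})$ split according to a length partition, ${\rm wt}_{SR}(\mathbf{c})=\sum_i{\rm rk}(\mathbf{c}^{(i)})$, and ${\rm d}_{SR}(\mathcal{C})$ is the minimum of ${\rm wt}_{SR}(\mathbf{c}-\mathbf{d})$ over distinct $\mathbf{c},\mathbf{d}\in\mathcal{C}$. *)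

theory Defs
  imports "HOL-Computational_Algebra.Polynomial" "HOL-Library.Extended_Nat"
    "Jordan_Normal_Form.Matrix"
begin

text \<open>R is a (nonzero) finite commutative ring whose ideals are totally ordered;
  since R is finite this is equivalent to: principal ideals are totally ordered.\<close>
definition chain_ring :: "'r::comm_ring_1 itself \<Rightarrow> bool" where
  "chain_ring _ \<longleftrightarrow> finite (UNIV :: 'r set) \<and> (1::'r) \<noteq> 0 \<and>
     (\<forall>a b :: 'r. a dvd b \<or> b dvd a)"

definition max_ideal :: "'r::comm_ring_1 set" where
  "max_ideal = {a. \<not> (a dvd 1)}"

text \<open>h is monic of degree m and irreducible modulo the maximal ideal:
  its image in (R/m)[x] (a polynomial over a field, of degree m) does not
  factor into two monic factors of positive degree.\<close>
definition monic_irred_mod_max :: "'r::comm_ring_1 poly \<Rightarrow> nat \<Rightarrow> bool" where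
  "monic_irred_mod_max h m \<longleftrightarrow> lead_coeff h = 1 \<and> degree h = m \<and> m \<ge> 1 \<and>
     \<not> (\<exists>f g. lead_coeff f = 1 \<and> lead_coeff g = 1 \<and> degree f \<ge> 1 \<and> degree g \<ge> 1 \<and>
           (\<forall>i. coeff (h - f * g) i \<in> max_ideal))"

text \<open>Elements of S = R[x]/(h) are represented by their unique reduced
  representatives, i.e. polynomials of degree < m; the R-basis of S used for
  coordinates is 1, x, ..., x^(m-1).\<close>
definition S_elems :: "nat \<Rightarrow> 'r::comm_ring_1 poly set" where
  "S_elems m = {p. p = 0 \<or> degree p < m}"

definition S_vecs :: "nat \<Rightarrow> nat \<Rightarrow> 'r::comm_ring_1 poly vec set" where
  "S_vecs m n = {v. dim_vec v = n \<and> (\<forall>i<n. v $ i \<in> S_elems m)}"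

definition vec_mat_S :: "'r::comm_ring_1 poly vec \<Rightarrow> 'r mat \<Rightarrow> 'r poly vec" where
  "vec_mat_S c A = vec (dim_col A) (\<lambda>j. \<Sum>i<dim_vec c. Polynomial.smult (A $$ (i, j)) (c $ i))"

definition snf_diag :: "'r::comm_ring_1 mat \<Rightarrow> (nat \<Rightarrow> 'r) \<Rightarrow> bool" where
  "snf_diag B d \<longleftrightarrow> (\<exists>P Q. P \<in> carrier_mat (dim_row B) (dim_row B) \<and>
       Q \<in> carrier_mat (dim_col B) (dim_col B) \<and> invertible_mat P \<and> invertible_mat Q \<and>
       P * B * Q = mat (dim_row B) (dim_col B) (\<lambda>(i, j). if i = j then d i else 0)) \<and>
     (\<forall>i. Suc i < min (dim_row B) (dim_col B) \<longrightarrow> d i dvd d (Suc i))"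

definition mat_rk :: "'r::comm_ring_1 mat \<Rightarrow> nat" where
  "mat_rk B = (SOME k. \<exists>d. snf_diag B d \<and>
       k = card {i. i < min (dim_row B) (dim_col B) \<and> d i \<noteq> 0})"

definition mat_frk :: "'r::comm_ring_1 mat \<Rightarrow> nat" where
  "mat_frk B = (SOME k. \<exists>d. snf_diag B d \<and>
       k = card {i. i < min (dim_row B) (dim_col B) \<and> d i dvd 1})"

definition coord_mat :: "nat \<Rightarrow> 'r::comm_ring_1 poly vec \<Rightarrow> 'r mat" where
  "coord_mat m u = mat m (dim_vec u) (\<lambda>(k, j). coeff (u $ j) k)"

definition vec_rk :: "nat \<Rightarrow> 'r::comm_ring_1 poly vec \<Rightarrow> nat" where
  "vec_rk m u = mat_rk (coord_mat m u)"

definition block :: "nat list \<Rightarrow> 'a vec \<Rightarrow> nat \<Rightarrow> 'a vec" where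
  "block ns c i = vec (ns ! i) (\<lambda>j. c $ (sum_list (take i ns) + j))"

definition wt_SR :: "nat \<Rightarrow> nat list \<Rightarrow> 'r::comm_ring_1 poly vec \<Rightarrow> nat" where
  "wt_SR m ns c = (\<Sum>i<length ns. vec_rk m (block ns c i))"

text \<open>Minimum sum-rank distance (\<infinity> if the code has fewer than two words).\<close>
definition d_SR :: "nat \<Rightarrow> nat list \<Rightarrow> 'r::comm_ring_1 poly vec set \<Rightarrow> enat" where
  "d_SR m ns C = (INF p \<in> {(c, d). c \<in> C \<and> d \<in> C \<and> c \<noteq> d}.
       enat (wt_SR m ns (fst p - snd p)))"

end

theory Submission
  imports Defs "Jordan_Normal_Form.Gauss_Jordan_Elimination"
begin

text \<open>Over a finite chain ring, rk B is the least k such that B factors through a free module of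
  rank k; hence rk is subadditive and does not grow under products. If s generates the socle, then
  frk A = rk (s A), so the free rank of a block diagonal matrix is at most the sum of the free ranks
  of its blocks. Inverting the unit invariant factors of A writes the identity as A G + H with
  rk H \<le> n - frk A, which yields rk X \<le> rk (X A) + (n - frk A). Summed over the blocks, this
  shows that two distinct codewords c, c' with c A + e = c' A + e' would satisfy
  wt(c - c') \<le> wt(e' - e) + \<rho> \<le> 2 t + \<rho>, contradicting the distance bound.\<close>

section \<open>Finite chain rings\<close>

lemma dvd_least_exists:
  fixes f :: "'b \<Rightarrow> 'r::comm_ring_1"
  assumes R: "chain_ring TYPE('r)" and "finite F" and "F \<noteq> {}"
  shows "\<exists>x\<in>F. \<forall>y\<in>F. f x dvd f y"
  using assms(2,3)
proof (induction F rule: finite_ne_induct)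
  case (insert z F)
  then obtain x where x: "x \<in> F" "\<forall>y\<in>F. f x dvd f y" by blast
  consider "f x dvd f z" | "f z dvd f x" using R unfolding chain_ring_def by blast
  then show ?case
  proof cases
    case 2
    then have "\<forall>y\<in>F. f z dvd f y" using x(2) dvd_trans by blast
    then show ?thesis by auto
  qed (use x in auto)
qed auto

lemma socle_element_exists:
  assumes R: "chain_ring TYPE('r::comm_ring_1)"
  shows "\<exists>s::'r. s \<noteq> 0 \<and> (\<forall>a. s * a = 0 \<longleftrightarrow> \<not> a dvd 1)"
proof -
  have fin: "finite (UNIV :: 'r set)" and one: "(1::'r) \<noteq> 0"
    using R unfolding chain_ring_def by auto
  define V where "V s = range (\<lambda>a. s * a)" for s :: 'r
  have finV: "finite (V s)" for s unfolding V_def using fin by simp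
  have "\<exists>s. s \<noteq> 0 \<and> (\<forall>y. y \<noteq> 0 \<longrightarrow> card (V s) \<le> card (V y))"
    using ex_has_least_nat[of "\<lambda>s::'r. s \<noteq> 0" 1 "\<lambda>s. card (V s)"] one by auto
  then obtain s where s: "s \<noteq> 0" and least: "\<And>y. y \<noteq> 0 \<Longrightarrow> card (V s) \<le> card (V y)" by blast
  have "s * a = 0 \<longleftrightarrow> \<not> a dvd 1" for a
  proof
    assume "s * a = 0"
    show "\<not> a dvd 1"
    proof
      assume "a dvd 1"
      then obtain b where "1 = a * b" by (elim dvdE)
      then have "s = s * a * b" by (simp add: mult.assoc flip: \<open>1 = a * b\<close>)
      then show False using \<open>s * a = 0\<close> s by simp
    qed
  next
    assume a: "\<not> a dvd 1"
    show "s * a = 0"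
    proof (rule ccontr)
      assume "s * a \<noteq> 0"
      moreover have "V (s * a) \<subseteq> V s" unfolding V_def by (auto simp: mult.assoc)
      ultimately have "V (s * a) = V s" using least finV by (metis card_seteq)
      moreover have "s \<in> V s" unfolding V_def by (metis mult_1_right rangeI)
      ultimately obtain b where b: "s = s * a * b" unfolding V_def by auto
      have "a * b dvd 1 - a * b \<or> 1 - a * b dvd a * b" using R unfolding chain_ring_def by blast
      moreover have "\<not> a * b dvd 1" using a dvd_mult_left by blast
      ultimately have "1 - a * b dvd a * b"
        by (metis diff_add_cancel dvd_add dvd_refl)
      then have "1 - a * b dvd 1" by (metis diff_add_cancel dvd_add dvd_refl)
      then obtain c where c: "1 = (1 - a * b) * c" by (elim dvdE)
      have "s * (1 - a * b) = 0" using b by (simp add: algebra_simps)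
      then have "s * ((1 - a * b) * c) = 0" by (simp flip: mult.assoc)
      then show False using s by (simp flip: c)
    qed
  qed
  then show ?thesis using s by blast
qed

text \<open>Eliminating a column with a pivot dividing all its entries only redefines the coefficient of
  the pivot row, so a unit coefficient among the other rows survives the induction.\<close>
lemma left_kernel_with_unit:
  fixes X :: "'b \<Rightarrow> nat \<Rightarrow> 'r::comm_ring_1"
  assumes R: "chain_ring TYPE('r)" and "finite I" and "k < card I"
  shows "\<exists>p. (\<exists>i\<in>I. p i dvd 1) \<and> (\<forall>a<k. (\<Sum>i\<in>I. p i * X i a) = 0)"
  using assms(2,3)
proof (induction k arbitrary: I X)
  case 0
  then obtain i where "i \<in> I" by fastforce
  then show ?case by (intro exI[of _ "\<lambda>_. 1"]) auto
next
  case (Suc k)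
  then have "I \<noteq> {}" by auto
  from dvd_least_exists[OF R Suc.prems(1) this, of "\<lambda>i. X i k"]
  obtain z where z: "z \<in> I" "\<forall>i\<in>I. X z k dvd X i k" by blast
  then have "\<forall>i. \<exists>q. i \<in> I \<longrightarrow> X i k = X z k * q" by (auto simp: dvd_def)
  then obtain q where q: "\<And>i. i \<in> I \<Longrightarrow> X i k = X z k * q i" by metis
  let ?I = "I - {z}"
  have "k < card ?I" using Suc.prems z(1) by simp
  from Suc.IH[OF _ this, of "\<lambda>i a. X i a - q i * X z a"] Suc.prems(1)
  obtain p where u: "\<exists>i\<in>?I. p i dvd 1"
    and p: "\<And>a. a < k \<Longrightarrow> (\<Sum>i\<in>?I. p i * (X i a - q i * X z a)) = 0" by auto
  define p' where "p' = p(z := - (\<Sum>i\<in>?I. p i * q i))"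
  have "(\<Sum>i\<in>I. p' i * X i a) = (\<Sum>i\<in>?I. p i * (X i a - q i * X z a))" for a
  proof -
    have "(\<Sum>i\<in>I. p' i * X i a) = p' z * X z a + (\<Sum>i\<in>?I. p' i * X i a)"
      using sum.remove[OF Suc.prems(1) z(1)] by blast
    also have "(\<Sum>i\<in>?I. p' i * X i a) = (\<Sum>i\<in>?I. p i * X i a)"
      by (intro sum.cong) (auto simp: p'_def)
    finally show ?thesis
      by (simp add: p'_def sum_distrib_right right_diff_distrib sum_subtractf mult.assoc)
  qed
  moreover have "(\<Sum>i\<in>?I. p i * (X i k - q i * X z k)) = 0"
    by (intro sum.neutral) (auto simp: q mult.commute)
  ultimately have "\<forall>a<Suc k. (\<Sum>i\<in>I. p' i * X i a) = 0" using p by (auto simp: less_Suc_eq)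
  moreover have "\<exists>i\<in>I. p' i dvd 1" using u by (auto simp: p'_def)
  ultimately show ?case by blast
qed

section \<open>Existence of the Smith normal form\<close>

lemma invertible_matI:
  "P \<in> carrier_mat n n \<Longrightarrow> P' \<in> carrier_mat n n \<Longrightarrow> P * P' = 1\<^sub>m n \<Longrightarrow> P' * P = 1\<^sub>m n
    \<Longrightarrow> invertible_mat P"
  unfolding invertible_mat_def inverts_mat_def by auto

lemma invertible_matE:
  assumes "invertible_mat P" "P \<in> carrier_mat n n"
  obtains P' where "P' \<in> carrier_mat n n" "P * P' = 1\<^sub>m n" "P' * P = 1\<^sub>m n"
proof -
  obtain P' where P': "P * P' = 1\<^sub>m n" "P' * P = 1\<^sub>m (dim_row P')"
    using assms unfolding invertible_mat_def inverts_mat_def by auto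
  have "dim_col P' = n" using arg_cong[OF P'(1), of dim_col] by simp
  moreover have "dim_row P' = n" using arg_cong[OF P'(2), of dim_col] assms(2) by simp
  ultimately show ?thesis using P' that by auto
qed

lemma invertible_mat_mult:
  assumes "invertible_mat P" "P \<in> carrier_mat n n" "invertible_mat Q" "Q \<in> carrier_mat n n"
  shows "invertible_mat (P * Q :: 'a::semiring_1 mat)"
proof -
  obtain P' where P': "P' \<in> carrier_mat n n" "P * P' = 1\<^sub>m n" "P' * P = 1\<^sub>m n"
    using invertible_matE assms(1,2) by blast
  obtain Q' where Q': "Q' \<in> carrier_mat n n" "Q * Q' = 1\<^sub>m n" "Q' * Q = 1\<^sub>m n"
    using invertible_matE assms(3,4) by blast
  have "Q * (Q' * P') = P'" "P' * (P * Q) = Q"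
    using assms P' Q' by (simp_all flip: assoc_mult_mat[of _ n n _ n _ n])
  then have "P * Q * (Q' * P') = 1\<^sub>m n" "Q' * P' * (P * Q) = 1\<^sub>m n"
    using assms P' Q' by (simp_all add: assoc_mult_mat[of _ n n _ n _ n])
  then show ?thesis
    using assms P' Q' by (intro invertible_matI[of _ n "Q' * P'"]) auto
qed

lemma invertible_mat_transpose:
  assumes "invertible_mat P" "P \<in> carrier_mat n n"
  shows "invertible_mat (transpose_mat P :: 'a::comm_semiring_1 mat)"
proof -
  obtain P' where P': "P' \<in> carrier_mat n n" "P * P' = 1\<^sub>m n" "P' * P = 1\<^sub>m n"
    using invertible_matE assms by blast
  have "transpose_mat P * transpose_mat P' = 1\<^sub>m n" "transpose_mat P' * transpose_mat P = 1\<^sub>m n"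
    by (simp_all add: P' flip: transpose_mult[OF P'(1) assms(2)] transpose_mult[OF assms(2) P'(1)])
  then show ?thesis using P' assms(2) by (intro invertible_matI[of _ n "transpose_mat P'"]) auto
qed

definition mat_equiv :: "'a::comm_ring_1 mat \<Rightarrow> 'a mat \<Rightarrow> bool" where
  "mat_equiv B C \<longleftrightarrow> (\<exists>P Q. P \<in> carrier_mat (dim_row B) (dim_row B) \<and>
     Q \<in> carrier_mat (dim_col B) (dim_col B) \<and> invertible_mat P \<and> invertible_mat Q \<and> P * B * Q = C)"

lemma invertible_one_mat: "invertible_mat (1\<^sub>m n :: 'a::comm_ring_1 mat)"
  by (rule invertible_matI[of _ n "1\<^sub>m n"]) auto

lemma mat_equiv_refl: "mat_equiv B B"
  unfolding mat_equiv_def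
  by (rule exI[of _ "1\<^sub>m (dim_row B)"], rule exI[of _ "1\<^sub>m (dim_col B)"])
    (auto simp: invertible_one_mat)

lemma mat_equiv_dim:
  assumes "mat_equiv B C"
  shows "dim_row C = dim_row B" "dim_col C = dim_col B"
  using assms unfolding mat_equiv_def by auto

lemma mat_equiv_trans:
  assumes "mat_equiv B C" "mat_equiv C D"
  shows "mat_equiv B D"
proof -
  define n m where "n = dim_row B" and "m = dim_col B"
  have B: "B \<in> carrier_mat n m" by (auto simp: n_def m_def)
  obtain P Q where PQ: "P \<in> carrier_mat n n" "Q \<in> carrier_mat m m"
      "invertible_mat P" "invertible_mat Q" "P * B * Q = C"
    using assms(1) unfolding mat_equiv_def n_def m_def by blast
  obtain P' Q' where PQ': "P' \<in> carrier_mat n n" "Q' \<in> carrier_mat m m"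
      "invertible_mat P'" "invertible_mat Q'" "P' * C * Q' = D"
    using assms(2) mat_equiv_dim[OF assms(1)] unfolding mat_equiv_def n_def m_def by auto
  have "(P' * P) * B * (Q * Q') = P' * C * Q'"
    unfolding PQ(5)[symmetric] using PQ(1,2) PQ'(1,2) B
    by (simp add: assoc_mult_mat[of _ n n _ n _ m] assoc_mult_mat[of _ n n _ m _ m]
        assoc_mult_mat[of _ n m _ m _ m] assoc_mult_mat[of _ n n _ n _ n])
  then show ?thesis
    unfolding mat_equiv_def n_def[symmetric] m_def[symmetric] using PQ PQ'
    by (intro exI[of _ "P' * P"] exI[of _ "Q * Q'"]) (auto intro!: invertible_mat_mult)
qed

lemma mat_equiv_mult_left:
  assumes "P \<in> carrier_mat (dim_row B) (dim_row B)" "invertible_mat P"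
  shows "mat_equiv B (P * B)"
  unfolding mat_equiv_def using assms
  by (intro exI[of _ P] exI[of _ "1\<^sub>m (dim_col B)"]) (auto simp: invertible_one_mat)

lemma mat_equiv_transpose:
  assumes "mat_equiv (transpose_mat B) (transpose_mat C)"
  shows "mat_equiv B C"
proof -
  define n m where "n = dim_row B" and "m = dim_col B"
  have B: "B \<in> carrier_mat n m" by (auto simp: n_def m_def)
  obtain P Q where PQ: "P \<in> carrier_mat m m" "Q \<in> carrier_mat n n"
      "invertible_mat P" "invertible_mat Q" "P * transpose_mat B * Q = transpose_mat C"
    using assms unfolding mat_equiv_def n_def m_def by auto
  have "transpose_mat (P * transpose_mat B * Q) = transpose_mat Q * B * transpose_mat P"
    using PQ(1,2) B
    by (simp add: transpose_mult[of _ m n _ n] transpose_mult[of _ m m _ n]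
        assoc_mult_mat[of _ n n _ m _ m])
  then have "transpose_mat Q * B * transpose_mat P = C" using PQ(5) by simp
  then show ?thesis
    unfolding mat_equiv_def n_def[symmetric] m_def[symmetric] using PQ
    by (intro exI[of _ "transpose_mat Q"] exI[of _ "transpose_mat P"])
      (auto intro: invertible_mat_transpose)
qed

lemma mat_equiv_swaprows:
  assumes "k < dim_row B" "l < dim_row B"
  shows "mat_equiv B (swaprows k l B)"
proof -
  have "invertible_mat (swaprows_mat (dim_row B) k l :: 'a mat)"
    using swaprows_mat_inv[OF assms] by (intro invertible_matI[of _ "dim_row B"]) auto
  then show ?thesis
    using mat_equiv_mult_left[of "swaprows_mat (dim_row B) k l" B]
      swaprows_mat[of B "dim_row B" "dim_col B" k l] assms by auto
qed

definition eliminate_rows :: "nat \<Rightarrow> (nat \<Rightarrow> 'a) \<Rightarrow> 'a::comm_ring_1 mat \<Rightarrow> 'a mat" where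
  "eliminate_rows k q B =
     mat (dim_row B) (dim_col B) (\<lambda>(i, j). B $$ (i, j) - q i * B $$ (k, j))"

lemma mat_equiv_eliminate_rows:
  assumes "k < dim_row B" "q k = 0"
  shows "mat_equiv B (eliminate_rows k q B)"
proof -
  define n where "n = dim_row B"
  define L :: "(nat \<Rightarrow> 'a) \<Rightarrow> 'a mat" where
    "L q = mat n n (\<lambda>(i, j). (if j = i then 1 else 0) - (if j = k then q i else 0))" for q
  have mult: "L q * M = eliminate_rows k q M" if "dim_row M = n" for q M
    using that assms(1)
    by (intro eq_matI) (auto simp: L_def eliminate_rows_def scalar_prod_def n_def
        left_diff_distrib sum_subtractf if_distrib[of "\<lambda>x. x * _"] cong: if_cong)
  have inv: "L q * L q' = 1\<^sub>m n" if "q k = 0" "q' k = 0" "\<And>i. q' i = - q i" for q q'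
    using that assms(1) unfolding n_def
    by (subst mult) (auto simp: L_def eliminate_rows_def n_def intro!: eq_matI)
  have "invertible_mat (L q)"
    using inv[of q "\<lambda>i. - q i"] inv[of "\<lambda>i. - q i" q] assms(2)
    by (intro invertible_matI[of _ n "L (\<lambda>i. - q i)"]) (auto simp: L_def)
  then show ?thesis
    using mat_equiv_mult_left[of "L q" B] mult[of B q] by (auto simp: L_def n_def)
qed

definition diagonal_upto :: "nat \<Rightarrow> 'a::comm_ring_1 mat \<Rightarrow> bool" where
  "diagonal_upto k M \<longleftrightarrow>
     (\<forall>i<dim_row M. \<forall>j<dim_col M. i \<noteq> j \<and> (i < k \<or> j < k) \<longrightarrow> M $$ (i, j) = 0) \<and>
     (\<forall>l<k. \<forall>i<dim_row M. \<forall>j<dim_col M. l \<le> i \<and> l \<le> j \<longrightarrow> M $$ (l, l) dvd M $$ (i, j))"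

definition pivot_at :: "nat \<Rightarrow> 'a::comm_ring_1 mat \<Rightarrow> bool" where
  "pivot_at k M \<longleftrightarrow> (\<forall>i<dim_row M. \<forall>j<dim_col M. k \<le> i \<and> k \<le> j \<longrightarrow> M $$ (k, k) dvd M $$ (i, j))"

lemma diagonal_upto_transpose: "diagonal_upto k M \<Longrightarrow> k \<le> dim_row M \<Longrightarrow> k \<le> dim_col M
    \<Longrightarrow> diagonal_upto k (transpose_mat M)"
  unfolding diagonal_upto_def by auto

lemma pivot_at_transpose: "pivot_at k M \<Longrightarrow> k < dim_row M \<Longrightarrow> k < dim_col M
    \<Longrightarrow> pivot_at k (transpose_mat M)"
  unfolding pivot_at_def by auto

lemma diagonal_upto_swaprows:
  assumes "diagonal_upto k M" "k \<le> l" "l < dim_row M" "k \<le> dim_col M"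
  shows "diagonal_upto k (swaprows k l M)"
  using assms unfolding diagonal_upto_def by (auto split: if_splits)

lemma diagonal_upto_eliminate_rows:
  assumes D: "diagonal_upto k M" and piv: "pivot_at k M" and k: "k < dim_row M" "k < dim_col M"
    and q: "\<And>i. i \<le> k \<Longrightarrow> q i = 0"
    and elim: "\<And>i. k < i \<Longrightarrow> i < dim_row M \<Longrightarrow> M $$ (i, k) = M $$ (k, k) * q i"
  defines "N \<equiv> eliminate_rows k q M"
  shows "diagonal_upto k N" "pivot_at k N" "\<forall>i<dim_row N. k < i \<longrightarrow> N $$ (i, k) = 0"
    "\<forall>j<dim_col N. N $$ (k, j) = M $$ (k, j)"
proof -
  have N: "N $$ (i, j) = M $$ (i, j) - q i * M $$ (k, j)" if "i < dim_row M" "j < dim_col M" for i j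
    using that by (simp add: N_def eliminate_rows_def)
  have dim: "dim_row N = dim_row M" "dim_col N = dim_col M"
    by (auto simp: N_def eliminate_rows_def)
  show "diagonal_upto k N"
    unfolding diagonal_upto_def dim
  proof (intro conjI allI impI)
    fix i j assume ij: "i < dim_row M" "j < dim_col M" "i \<noteq> j \<and> (i < k \<or> j < k)"
    show "N $$ (i, j) = 0"
      using ij D k q[of i] unfolding N[OF ij(1,2)] diagonal_upto_def by (cases "i < k") auto
  next
    fix l i j assume a: "l < k" "i < dim_row M" "j < dim_col M" "l \<le> i \<and> l \<le> j"
    have "N $$ (l, l) = M $$ (l, l)" using a k q[of l] by (subst N) auto
    moreover have "M $$ (l, l) dvd M $$ (i, j)" "M $$ (l, l) dvd M $$ (k, j)"
      using D a k unfolding diagonal_upto_def by auto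
    ultimately show "N $$ (l, l) dvd N $$ (i, j)" using a by (simp add: N)
  qed
  have kk: "N $$ (k, k) = M $$ (k, k)" using k q[of k] by (subst N) auto
  show "pivot_at k N"
    using piv k unfolding pivot_at_def dim kk by (auto simp: N)
  show "\<forall>i<dim_row N. k < i \<longrightarrow> N $$ (i, k) = 0"
    using k elim by (auto simp: dim N mult.commute)
  show "\<forall>j<dim_col N. N $$ (k, j) = M $$ (k, j)"
    using k q by (auto simp: dim N)
qed

lemma clear_column:
  assumes "diagonal_upto k M" "pivot_at k M" "k < dim_row M" "k < dim_col M"
  shows "\<exists>N. mat_equiv M N \<and> diagonal_upto k N \<and> pivot_at k N \<and>
    (\<forall>i<dim_row M. k < i \<longrightarrow> N $$ (i, k) = 0) \<and> (\<forall>j<dim_col M. N $$ (k, j) = M $$ (k, j))"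
proof -
  have "\<forall>i. \<exists>q. (i \<le> k \<longrightarrow> q = 0) \<and> (k < i \<and> i < dim_row M \<longrightarrow> M $$ (i, k) = M $$ (k, k) * q)"
    using assms unfolding pivot_at_def by (metis dvdE leD less_or_eq_imp_le)
  then obtain q where q: "\<And>i. i \<le> k \<Longrightarrow> q i = 0"
      "\<And>i. k < i \<Longrightarrow> i < dim_row M \<Longrightarrow> M $$ (i, k) = M $$ (k, k) * q i" by metis
  have "mat_equiv M (eliminate_rows k q M)" using mat_equiv_eliminate_rows q(1) assms by blast
  with diagonal_upto_eliminate_rows[OF assms q] mat_equiv_dim[OF this] show ?thesis by auto
qed

lemma diagonal_upto_step:
  fixes M :: "'r::comm_ring_1 mat"
  assumes R: "chain_ring TYPE('r)"
    and D: "diagonal_upto k M" and k: "k < dim_row M" "k < dim_col M"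
  shows "\<exists>N. mat_equiv M N \<and> diagonal_upto (Suc k) N"
proof -
  let ?F = "{k..<dim_row M} \<times> {k..<dim_col M}"
  have "\<exists>x\<in>?F. \<forall>y\<in>?F. M $$ x dvd M $$ y" using k by (intro dvd_least_exists[OF R]) auto
  then obtain i0 j0 where ij0: "k \<le> i0" "i0 < dim_row M" "k \<le> j0" "j0 < dim_col M"
    and piv: "\<And>i j. k \<le> i \<Longrightarrow> i < dim_row M \<Longrightarrow> k \<le> j \<Longrightarrow> j < dim_col M
      \<Longrightarrow> M $$ (i0, j0) dvd M $$ (i, j)" by auto
  define M1 where "M1 = swaprows k i0 M"
  have dim1: "dim_row M1 = dim_row M" "dim_col M1 = dim_col M" by (auto simp: M1_def)
  have M1: "mat_equiv M M1" "diagonal_upto k M1"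
    unfolding M1_def using k ij0 D by (auto intro!: mat_equiv_swaprows diagonal_upto_swaprows)
  define M2 where "M2 = swaprows k j0 (transpose_mat M1)"
  have dim2: "dim_row M2 = dim_col M" "dim_col M2 = dim_row M" by (auto simp: M2_def dim1)
  have M2: "mat_equiv (transpose_mat M1) M2" "diagonal_upto k M2"
    unfolding M2_def using k ij0 M1 dim1
    by (auto intro!: mat_equiv_swaprows diagonal_upto_swaprows diagonal_upto_transpose)
  have "M2 $$ (k, k) = M $$ (i0, j0)" using k ij0 by (simp add: M2_def M1_def)
  then have "pivot_at k M2"
    using k ij0 piv unfolding pivot_at_def dim2 by (auto simp: M2_def M1_def)
  with clear_column[OF M2(2)] k dim2 obtain M3 where M3: "mat_equiv M2 M3" "diagonal_upto k M3"
    "pivot_at k M3" "\<forall>i<dim_row M2. k < i \<longrightarrow> M3 $$ (i, k) = 0" by auto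
  have dim3: "dim_row M3 = dim_col M" "dim_col M3 = dim_row M"
    using mat_equiv_dim[OF M3(1)] dim2 by auto
  have "diagonal_upto k (transpose_mat M3)" "pivot_at k (transpose_mat M3)"
    using M3 k dim3 by (auto intro!: diagonal_upto_transpose pivot_at_transpose)
  from clear_column[OF this] k dim3 obtain M4 where M4: "mat_equiv (transpose_mat M3) M4"
    "diagonal_upto k M4" "pivot_at k M4" "\<forall>i<dim_row M. k < i \<longrightarrow> M4 $$ (i, k) = 0"
    "\<forall>j<dim_col M. M4 $$ (k, j) = transpose_mat M3 $$ (k, j)" by auto
  have dim4: "dim_row M4 = dim_row M" "dim_col M4 = dim_col M"
    using mat_equiv_dim[OF M4(1)] dim3 by auto
  have "mat_equiv M1 (transpose_mat M3)"
    using mat_equiv_trans[OF M2(1) M3(1)] by (simp add: mat_equiv_transpose)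
  then have "mat_equiv M M4" using M1(1) M4(1) mat_equiv_trans by blast
  moreover have "M4 $$ (k, j) = 0" if "k \<noteq> j" "j < dim_col M" for j
    using that M4(2,5) M3(4) k dim3 dim2 dim4 unfolding diagonal_upto_def
    by (cases "k < j") auto
  then have "diagonal_upto (Suc k) M4"
    using M4(2-4) k unfolding diagonal_upto_def pivot_at_def dim4
    by (auto simp: less_Suc_eq)
  ultimately show ?thesis by blast
qed

lemma snf_diag_exists:
  fixes B :: "'r::comm_ring_1 mat"
  assumes R: "chain_ring TYPE('r)"
  shows "\<exists>d. snf_diag B d"
proof -
  have "k \<le> min (dim_row B) (dim_col B) \<Longrightarrow> \<exists>M. mat_equiv B M \<and> diagonal_upto k M" for k
  proof (induction k)
    case 0
    show ?case using mat_equiv_refl by (intro exI[of _ B]) (auto simp: diagonal_upto_def)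
  next
    case (Suc k)
    then obtain M where M: "mat_equiv B M" "diagonal_upto k M" by auto
    have "k < dim_row M" "k < dim_col M" using mat_equiv_dim[OF M(1)] Suc.prems by auto
    from diagonal_upto_step[OF R M(2) this] show ?case using M(1) mat_equiv_trans by blast
  qed
  from this[of "min (dim_row B) (dim_col B)"] obtain M where
    M: "mat_equiv B M" "diagonal_upto (min (dim_row B) (dim_col B)) M" by auto
  note dim = mat_equiv_dim[OF M(1)]
  have diag: "M = mat (dim_row B) (dim_col B) (\<lambda>(i, j). if i = j then M $$ (i, i) else 0)"
    using M(2) dim unfolding diagonal_upto_def by (intro eq_matI) (auto simp: min_def split: if_splits)
  have dvd: "M $$ (i, i) dvd M $$ (Suc i, Suc i)" if "Suc i < min (dim_row B) (dim_col B)" for i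
    using M(2) dim that unfolding diagonal_upto_def by auto
  have "mat_equiv B (mat (dim_row B) (dim_col B) (\<lambda>(i, j). if i = j then M $$ (i, i) else 0))"
    using M(1) by (subst (asm) diag)
  then have "snf_diag B (\<lambda>i. M $$ (i, i))"
    using dvd unfolding snf_diag_def mat_equiv_def by blast
  then show ?thesis by blast
qed

section \<open>Rank as least factorisation length\<close>

definition rank_le :: "'a::comm_ring_1 mat \<Rightarrow> nat \<Rightarrow> bool" where
  "rank_le B k \<longleftrightarrow> (\<exists>f g. \<forall>i<dim_row B. \<forall>j<dim_col B. B $$ (i, j) = (\<Sum>a<k. f i a * g a j))"

lemma rank_le_finite:
  assumes "finite F"
    and B: "\<And>i j. i < dim_row B \<Longrightarrow> j < dim_col B \<Longrightarrow> B $$ (i, j) = (\<Sum>a\<in>F. f i a * g a j)"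
  shows "rank_le B (card F)"
proof -
  obtain h where h: "bij_betw h {0..<card F} F" using ex_bij_betw_nat_finite[OF assms(1)] by blast
  have "(\<Sum>a\<in>F. f i a * g a j) = (\<Sum>a<card F. f i (h a) * g (h a) j)" for i j
    using sum.reindex_bij_betw[OF h, of "\<lambda>a. f i a * g a j"] by (simp add: atLeast0LessThan)
  then show ?thesis
    unfolding rank_le_def using B
    by (intro exI[of _ "\<lambda>i a. f i (h a)"] exI[of _ "\<lambda>a j. g (h a) j"]) auto
qed

lemma rank_le_add:
  assumes "B \<in> carrier_mat n m" "C \<in> carrier_mat n m" "rank_le B k" "rank_le C l"
  shows "rank_le (B + C) (k + l)"
proof -
  obtain f g where fg: "\<And>i j. i < n \<Longrightarrow> j < m \<Longrightarrow> B $$ (i, j) = (\<Sum>a<k. f i a * g a j)"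
    using assms(1,3) unfolding rank_le_def by auto
  obtain f' g' where fg': "\<And>i j. i < n \<Longrightarrow> j < m \<Longrightarrow> C $$ (i, j) = (\<Sum>a<l. f' i a * g' a j)"
    using assms(2,4) unfolding rank_le_def by auto
  have "rank_le (B + C) (card ({..<k} <+> {..<l}))"
    using assms(1,2) fg fg'
    by (intro rank_le_finite[where f = "\<lambda>i. case_sum (f i) (f' i)"
          and g = "\<lambda>a j. case_sum (\<lambda>a. g a j) (\<lambda>a. g' a j) a"]) (auto simp: sum.Plus)
  then show ?thesis by (simp add: card_Plus)
qed

lemma rank_le_four_block:
  assumes "rank_le A k" "rank_le D l"
  shows "rank_le (four_block_mat A (0\<^sub>m (dim_row A) (dim_col D)) (0\<^sub>m (dim_row D) (dim_col A)) D) (k + l)"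
    (is "rank_le ?M _")
proof -
  obtain f g where fg: "\<And>i j. i < dim_row A \<Longrightarrow> j < dim_col A \<Longrightarrow> A $$ (i, j) = (\<Sum>a<k. f i a * g a j)"
    using assms(1) unfolding rank_le_def by auto
  obtain f' g' where fg': "\<And>i j. i < dim_row D \<Longrightarrow> j < dim_col D \<Longrightarrow> D $$ (i, j) = (\<Sum>a<l. f' i a * g' a j)"
    using assms(2) unfolding rank_le_def by auto
  have "rank_le ?M (card ({..<k} <+> {..<l}))"
    by (rule rank_le_finite[where
          f = "\<lambda>i. case_sum (\<lambda>a. if i < dim_row A then f i a else 0)
             (\<lambda>a. if i < dim_row A then 0 else f' (i - dim_row A) a)"
          and g = "\<lambda>a j. case_sum (\<lambda>a. if j < dim_col A then g a j else 0)
             (\<lambda>a. if j < dim_col A then 0 else g' a (j - dim_col A)) a"])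
      (auto simp: sum.Plus fg fg')
  then show ?thesis by (simp add: card_Plus)
qed

lemma rank_le_mult:
  assumes "B \<in> carrier_mat n m" "C \<in> carrier_mat m p" "rank_le B k \<or> rank_le C k"
  shows "rank_le (B * C) k"
  using assms(3)
proof
  assume "rank_le B k"
  then obtain f g where fg: "\<And>i j. i < n \<Longrightarrow> j < m \<Longrightarrow> B $$ (i, j) = (\<Sum>a<k. f i a * g a j)"
    using assms(1) unfolding rank_le_def by auto
  have "(B * C) $$ (i, j) = (\<Sum>a<k. f i a * (\<Sum>l<m. g a l * C $$ (l, j)))" if "i < n" "j < p" for i j
  proof -
    have "(B * C) $$ (i, j) = (\<Sum>l<m. (\<Sum>a<k. f i a * g a l) * C $$ (l, j))"
      using assms(1,2) that fg by (auto simp: scalar_prod_def atLeast0LessThan intro!: sum.cong)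
    also have "\<dots> = (\<Sum>a<k. f i a * (\<Sum>l<m. g a l * C $$ (l, j)))"
      by (subst sum_distrib_right, subst sum.swap) (simp add: sum_distrib_left mult.assoc)
    finally show ?thesis .
  qed
  then show ?thesis
    unfolding rank_le_def using assms(1,2)
    by (intro exI[of _ f] exI[of _ "\<lambda>a j. \<Sum>l<m. g a l * C $$ (l, j)"]) auto
next
  assume "rank_le C k"
  then obtain f g where fg: "\<And>i j. i < m \<Longrightarrow> j < p \<Longrightarrow> C $$ (i, j) = (\<Sum>a<k. f i a * g a j)"
    using assms(2) unfolding rank_le_def by auto
  have "(B * C) $$ (i, j) = (\<Sum>a<k. (\<Sum>l<m. B $$ (i, l) * f l a) * g a j)" if "i < n" "j < p" for i j
  proof -
    have "(B * C) $$ (i, j) = (\<Sum>l<m. B $$ (i, l) * (\<Sum>a<k. f l a * g a j))"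
      using assms(1,2) that fg by (auto simp: scalar_prod_def atLeast0LessThan intro!: sum.cong)
    also have "\<dots> = (\<Sum>a<k. (\<Sum>l<m. B $$ (i, l) * f l a) * g a j)"
      by (subst sum_distrib_left, subst sum.swap) (simp add: sum_distrib_right mult.assoc)
    finally show ?thesis .
  qed
  then show ?thesis
    unfolding rank_le_def using assms(1,2)
    by (intro exI[of _ "\<lambda>i a. \<Sum>l<m. B $$ (i, l) * f l a"] exI[of _ g]) auto
qed

lemma rank_le_diag:
  "rank_le (mat n m (\<lambda>(i, j). if i = j then d i else 0)) (card {i. i < min n m \<and> d i \<noteq> 0})"
proof (rule rank_le_finite[where f = "\<lambda>i a. if a = i then d i else 0" and g = "\<lambda>a j. if a = j then 1 else 0"])
  fix i j assume "i < dim_row (mat n m (\<lambda>(i, j). if i = j then d i else 0))"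
    and "j < dim_col (mat n m (\<lambda>(i, j). if i = j then d i else 0))"
  then show "mat n m (\<lambda>(i, j). if i = j then d i else 0) $$ (i, j) =
    (\<Sum>a\<in>{i. i < min n m \<and> d i \<noteq> 0}. (if a = i then d i else 0) * (if a = j then 1 else 0))"
    by (auto simp: if_distrib[of "\<lambda>x. x * _"] cong: if_cong)
qed auto

lemma rank_le_snf_diag:
  assumes "snf_diag B d"
  shows "rank_le B (card {i. i < min (dim_row B) (dim_col B) \<and> d i \<noteq> 0})"
proof -
  define n m where "n = dim_row B" and "m = dim_col B"
  have B: "B \<in> carrier_mat n m" by (auto simp: n_def m_def)
  let ?D = "mat n m (\<lambda>(i, j). if i = j then d i else 0)"
  obtain P Q where PQ: "P \<in> carrier_mat n n" "Q \<in> carrier_mat m m" "invertible_mat P"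
    "invertible_mat Q" "P * B * Q = ?D"
    using assms unfolding snf_diag_def n_def m_def by blast
  obtain P' where P': "P' \<in> carrier_mat n n" "P * P' = 1\<^sub>m n" "P' * P = 1\<^sub>m n"
    using invertible_matE PQ by blast
  obtain Q' where Q': "Q' \<in> carrier_mat m m" "Q * Q' = 1\<^sub>m m" "Q' * Q = 1\<^sub>m m"
    using invertible_matE PQ by blast
  have "P' * (P * B * Q) * Q' = (P' * P) * B * (Q * Q')"
    using PQ(1,2) P'(1) Q'(1) B
    by (simp add: assoc_mult_mat[of _ n n _ n _ m] assoc_mult_mat[of _ n n _ m _ m]
        assoc_mult_mat[of _ n m _ m _ m] assoc_mult_mat[of _ n n _ n _ n])
  then have eq: "B = P' * ?D * Q'" using PQ(5) P' Q' B by simp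
  have "rank_le (P' * ?D * Q') (card {i. i < min n m \<and> d i \<noteq> 0})"
    using P' Q' rank_le_diag[of n m d]
    by (intro rank_le_mult[of _ n m _ m] disjI1 rank_le_mult[of P' n n ?D m] disjI2) auto
  then show ?thesis unfolding eq[symmetric] unfolding n_def m_def .
qed

text \<open>A vector killing the left factor, scaled by the quotients of the largest nonzero invariant
  factor by the others, would annihilate that factor.\<close>
lemma snf_diag_le_rank:
  fixes B :: "'r::comm_ring_1 mat"
  assumes R: "chain_ring TYPE('r)" and snf: "snf_diag B d" and "rank_le B k"
  shows "card {i. i < min (dim_row B) (dim_col B) \<and> d i \<noteq> 0} \<le> k"
proof (rule ccontr)
  define n m where "n = dim_row B" and "m = dim_col B"
  have B: "B \<in> carrier_mat n m" by (auto simp: n_def m_def)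
  let ?D = "mat n m (\<lambda>(i, j). if i = j then d i else 0)"
  let ?I = "{i. i < min n m \<and> d i \<noteq> 0}"
  assume "\<not> card {i. i < min (dim_row B) (dim_col B) \<and> d i \<noteq> 0} \<le> k"
  then have card: "k < card ?I" by (simp add: n_def m_def)
  obtain P Q where PQ: "P \<in> carrier_mat n n" "Q \<in> carrier_mat m m" "P * B * Q = ?D"
    using snf unfolding snf_diag_def n_def m_def by blast
  have chain: "d i dvd d j" if "i \<le> j" "j < min n m" for i j
    using that
  proof (induction j rule: dec_induct)
    case (step j)
    then show ?case using snf dvd_trans unfolding snf_diag_def n_def m_def by fastforce
  qed simp
  have fin: "finite ?I" by simp
  have ne: "?I \<noteq> {}" using card by (metis card.empty less_nat_zero_code)
  define z where "z = Max ?I"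
  have z: "z \<in> ?I" unfolding z_def using Max_in[OF fin ne] .
  have "d i dvd d z" if "i \<in> ?I" for i
    using z Max_ge[OF fin that] unfolding z_def[symmetric] by (intro chain) auto
  then have "\<forall>i. \<exists>c. i \<in> ?I \<longrightarrow> d z = d i * c" unfolding dvd_def by blast
  then obtain c where c: "\<And>i. i \<in> ?I \<Longrightarrow> d z = d i * c i" by metis
  have "rank_le (P * B * Q) k"
    using PQ(1,2) B \<open>rank_le B k\<close>
    by (intro rank_le_mult[of _ n m _ m] disjI1 rank_le_mult[of P n n B m] disjI2) auto
  then obtain f g where fg: "\<And>i j. i < n \<Longrightarrow> j < m \<Longrightarrow> ?D $$ (i, j) = (\<Sum>a<k. f i a * g a j)"
    unfolding rank_le_def PQ(3) by auto
  obtain p u where u: "u \<in> ?I" "p u dvd 1"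
    and p: "\<And>a. a < k \<Longrightarrow> (\<Sum>i\<in>?I. p i * (c i * f i a)) = 0"
    using left_kernel_with_unit[OF R fin card, of "\<lambda>i a. c i * f i a"] by blast
  have "p u * d z = (\<Sum>i\<in>?I. p i * (c i * (if i = u then d i else 0)))"
    using u(1) c[OF u(1)] by (simp add: if_distrib[of "\<lambda>x. _ * x"] mult.commute cong: if_cong)
  also have "\<dots> = (\<Sum>i\<in>?I. p i * (c i * (\<Sum>a<k. f i a * g a u)))"
    using u(1) by (intro sum.cong refl) (simp flip: fg)
  also have "\<dots> = (\<Sum>a<k. (\<Sum>i\<in>?I. p i * (c i * f i a)) * g a u)"
    by (simp only: sum_distrib_left sum_distrib_right, subst sum.swap) (simp add: mult.assoc)
  also have "\<dots> = 0" using p by simp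
  finally have "p u * d z = 0" .
  moreover obtain v where "1 = p u * v" using u(2) by (elim dvdE)
  ultimately have "d z = 0" by (metis mult.assoc mult.commute mult_1 mult_zero_left)
  then show False using z by simp
qed

lemma rank_le_mat_rk:
  fixes B :: "'r::comm_ring_1 mat"
  assumes R: "chain_ring TYPE('r)"
  shows "rank_le B (mat_rk B)" and "rank_le B k \<Longrightarrow> mat_rk B \<le> k"
proof -
  have "\<exists>k d. snf_diag B d \<and> k = card {i. i < min (dim_row B) (dim_col B) \<and> d i \<noteq> 0}"
    using snf_diag_exists[OF R] by blast
  from someI_ex[OF this] obtain d where
    d: "snf_diag B d" "mat_rk B = card {i. i < min (dim_row B) (dim_col B) \<and> d i \<noteq> 0}"
    unfolding mat_rk_def by blast
  show "rank_le B (mat_rk B)" unfolding d(2) by (rule rank_le_snf_diag[OF d(1)])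
  show "rank_le B k \<Longrightarrow> mat_rk B \<le> k" unfolding d(2) by (rule snf_diag_le_rank[OF R d(1)])
qed

lemma mat_frk_snf_diag:
  fixes A :: "'r::comm_ring_1 mat"
  assumes R: "chain_ring TYPE('r)"
  obtains d where "snf_diag A d"
    "mat_frk A = card {i. i < min (dim_row A) (dim_col A) \<and> d i dvd 1}"
proof -
  have "\<exists>k d. snf_diag A d \<and> k = card {i. i < min (dim_row A) (dim_col A) \<and> d i dvd 1}"
    using snf_diag_exists[OF R] by blast
  from someI_ex[OF this] show ?thesis using that unfolding mat_frk_def by blast
qed

lemma snf_diag_smult:
  assumes "snf_diag B d"
  shows "snf_diag (s \<cdot>\<^sub>m B) (\<lambda>i. s * d i)"
proof -
  define n m where "n = dim_row B" and "m = dim_col B"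
  have B: "B \<in> carrier_mat n m" by (auto simp: n_def m_def)
  obtain P Q where PQ: "P \<in> carrier_mat n n" "Q \<in> carrier_mat m m" "invertible_mat P"
    "invertible_mat Q" "P * B * Q = mat n m (\<lambda>(i, j). if i = j then d i else 0)"
    and dvd: "\<forall>i. Suc i < min n m \<longrightarrow> d i dvd d (Suc i)"
    using assms unfolding snf_diag_def n_def m_def by blast
  have "P * (s \<cdot>\<^sub>m B) * Q = s \<cdot>\<^sub>m (P * B * Q)"
    using PQ(1,2) B by (simp add: mult_smult_distrib[of _ n n _ m] mult_smult_assoc_mat[of _ n m _ m])
  also have "\<dots> = mat n m (\<lambda>(i, j). if i = j then s * d i else 0)"
    unfolding PQ(5) by (intro eq_matI) auto
  finally have "P * (s \<cdot>\<^sub>m B) * Q = mat n m (\<lambda>(i, j). if i = j then s * d i else 0)" .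
  moreover have "\<forall>i. Suc i < min n m \<longrightarrow> s * d i dvd s * d (Suc i)" using dvd by (simp add: mult_dvd_mono)
  ultimately show ?thesis
    unfolding snf_diag_def using PQ(1-4) by (auto simp flip: n_def m_def)
qed

text \<open>Multiplication by a generator of the socle kills exactly the non-unit invariant factors.\<close>
lemma rank_le_mat_frk:
  fixes A :: "'r::comm_ring_1 mat"
  assumes R: "chain_ring TYPE('r)" and s: "\<forall>a. s * a = 0 \<longleftrightarrow> \<not> a dvd 1"
  shows "rank_le (s \<cdot>\<^sub>m A) (mat_frk A)" and "rank_le (s \<cdot>\<^sub>m A) k \<Longrightarrow> mat_frk A \<le> k"
proof -
  obtain d where d: "snf_diag A d"
    "mat_frk A = card {i. i < min (dim_row A) (dim_col A) \<and> d i dvd 1}"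
    using mat_frk_snf_diag[OF R] .
  have frk: "mat_frk A = card {i. i < min (dim_row (s \<cdot>\<^sub>m A)) (dim_col (s \<cdot>\<^sub>m A)) \<and> s * d i \<noteq> 0}"
    unfolding d(2) using s by simp
  note sd = snf_diag_smult[OF d(1), of s]
  show "rank_le (s \<cdot>\<^sub>m A) (mat_frk A)" unfolding frk by (rule rank_le_snf_diag[OF sd])
  show "rank_le (s \<cdot>\<^sub>m A) k \<Longrightarrow> mat_frk A \<le> k" unfolding frk by (rule snf_diag_le_rank[OF R sd])
qed

lemma mat_frk_diag_block_mat:
  fixes As :: "'r::comm_ring_1 mat list"
  assumes R: "chain_ring TYPE('r)"
  shows "mat_frk (diag_block_mat As) \<le> (\<Sum>A\<leftarrow>As. mat_frk A)"
proof -
  obtain s :: 'r where s: "\<forall>a. s * a = 0 \<longleftrightarrow> \<not> a dvd 1" using socle_element_exists[OF R] by blast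
  have "rank_le (s \<cdot>\<^sub>m diag_block_mat As) (\<Sum>A\<leftarrow>As. mat_frk A)"
  proof (induction As)
    case (Cons A As)
    let ?D = "diag_block_mat As"
    have "s \<cdot>\<^sub>m diag_block_mat (A # As) = four_block_mat (s \<cdot>\<^sub>m A)
      (0\<^sub>m (dim_row (s \<cdot>\<^sub>m A)) (dim_col (s \<cdot>\<^sub>m ?D))) (0\<^sub>m (dim_row (s \<cdot>\<^sub>m ?D)) (dim_col (s \<cdot>\<^sub>m A))) (s \<cdot>\<^sub>m ?D)"
      by (intro eq_matI) (auto simp: Let_def)
    then show ?case using rank_le_four_block[OF rank_le_mat_frk(1)[OF R s] Cons.IH] by simp
  qed (simp add: rank_le_def)
  then show ?thesis by (rule rank_le_mat_frk(2)[OF R s])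
qed

text \<open>Inverting the unit invariant factors gives a partial right inverse G of A.\<close>
lemma partial_right_inverse:
  fixes A :: "'r::comm_ring_1 mat"
  assumes R: "chain_ring TYPE('r)" and A: "A \<in> carrier_mat n m"
  obtains G H where "G \<in> carrier_mat m n" "H \<in> carrier_mat n n" "1\<^sub>m n = A * G + H"
    "rank_le H (n - mat_frk A)"
proof -
  obtain d where snf: "snf_diag A d" and frk: "mat_frk A = card {i. i < min n m \<and> d i dvd 1}"
    using mat_frk_snf_diag[OF R, of A] A by auto
  let ?D = "mat n m (\<lambda>(i, j). if i = j then d i else 0)"
  obtain P Q where PQ: "P \<in> carrier_mat n n" "Q \<in> carrier_mat m m" "invertible_mat P"
    "invertible_mat Q" "P * A * Q = ?D"
    using snf A unfolding snf_diag_def by auto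
  obtain P' where P': "P' \<in> carrier_mat n n" "P * P' = 1\<^sub>m n" "P' * P = 1\<^sub>m n"
    using invertible_matE PQ by blast
  define U where "U = {i. i < min n m \<and> d i dvd 1}"
  have "\<forall>i. \<exists>c. i \<in> U \<longrightarrow> 1 = d i * c" unfolding U_def dvd_def by blast
  then obtain c where c: "\<And>i. i \<in> U \<Longrightarrow> d i * c i = 1" by metis
  define E where "E = mat m n (\<lambda>(i, j). if i = j \<and> i \<in> U then c i else 0)"
  define F where "F = mat n n (\<lambda>(i, j). if i = j then (if i \<in> U then 0 else 1) else 0 :: 'r)"
  have E: "E \<in> carrier_mat m n" and F: "F \<in> carrier_mat n n" by (auto simp: E_def F_def)
  have "?D * E + F = 1\<^sub>m n"
  proof (rule eq_matI)
    fix i j assume ij: "i < dim_row (1\<^sub>m n :: 'r mat)" "j < dim_col (1\<^sub>m n :: 'r mat)"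
    have "(?D * E) $$ (i, j) = (\<Sum>l\<in>{0..<m}. (if i = l then d i else 0) * (if l = j \<and> l \<in> U then c l else 0))"
      using ij by (simp add: E_def scalar_prod_def)
    also have "\<dots> = (\<Sum>l\<in>{0..<m}. if l = i then d i * (if i = j \<and> i \<in> U then c i else 0) else 0)"
      by (intro sum.cong) auto
    also have "\<dots> = (if i = j \<and> i \<in> U then 1 else 0)" using c by (auto simp: U_def)
    finally show "(?D * E + F) $$ (i, j) = 1\<^sub>m n $$ (i, j)"
      using ij E F by (auto simp: F_def)
  qed (auto simp: F_def)
  then have DE: "P * A * Q * E + F = 1\<^sub>m n" using PQ(5) by simp
  define G where "G = Q * (E * P)"
  define H where "H = P' * F * P"
  have G: "G \<in> carrier_mat m n" and H: "H \<in> carrier_mat n n"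
    using PQ P' E F by (auto simp: G_def H_def)
  have AQE: "A * Q * E \<in> carrier_mat n n" "A * Q \<in> carrier_mat n m" using A PQ E by auto
  have "P' * (P * A * Q * E + F) * P = P' * (P * (A * Q * E) + F) * P"
    using A PQ(1,2) E by (simp add: assoc_mult_mat[of _ n n _ m _ m] assoc_mult_mat[of _ n n _ m _ n]
        assoc_mult_mat[of _ n m _ m _ n] assoc_mult_mat[of _ n m _ m _ m])
  also have "\<dots> = (P' * (P * (A * Q * E)) + P' * F) * P"
    using PQ(1) P'(1) F AQE by (simp add: mult_add_distrib_mat[of _ n n _ n])
  also have "P' * (P * (A * Q * E)) = A * Q * E"
    using AQE PQ(1) P' left_mult_one_mat[OF AQE(1)]
    by (simp flip: assoc_mult_mat[of P' n n P n _ n])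
  also have "(A * Q * E + P' * F) * P = A * Q * E * P + H"
    unfolding H_def using AQE P'(1) F PQ(1) by (simp add: add_mult_distrib_mat[of _ n n _ _ n])
  also have "A * Q * E * P = A * G"
    unfolding G_def using A PQ(1,2) E AQE by (simp add: assoc_mult_mat[of _ n m _ m _ n]
        assoc_mult_mat[of _ n m _ n _ n] assoc_mult_mat[of _ n m _ m _ n])
  finally have one: "1\<^sub>m n = A * G + H" using DE P' PQ(1) by simp
  have "card {i. i < min n n \<and> (if i \<in> U then 0 else 1 :: 'r) \<noteq> 0} = card ({..<n} - U)"
    using R unfolding chain_ring_def by (intro arg_cong[of _ _ card]) auto
  also have "\<dots> = n - mat_frk A"
    unfolding frk U_def by (subst card_Diff_subset) auto
  finally have "rank_le F (n - mat_frk A)"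
    using rank_le_diag[of n n "\<lambda>i. if i \<in> U then 0 else 1 :: 'r"] by (simp add: F_def)
  then have "rank_le H (n - mat_frk A)"
    unfolding H_def using PQ(1) P'(1) F
    by (intro rank_le_mult[of _ n n _ n] disjI1 rank_le_mult[of P' n n F n] disjI2) auto
  then show ?thesis using that G H one by blast
qed

lemma mat_rk_mult_ge:
  fixes X :: "'r::comm_ring_1 mat"
  assumes R: "chain_ring TYPE('r)" and X: "X \<in> carrier_mat p n" and A: "A \<in> carrier_mat n m"
  shows "mat_rk X \<le> mat_rk (X * A) + (n - mat_frk A)"
proof -
  obtain G H where GH: "G \<in> carrier_mat m n" "H \<in> carrier_mat n n" "1\<^sub>m n = A * G + H"
    "rank_le H (n - mat_frk A)" using partial_right_inverse[OF R A] .
  have "X = X * (A * G + H)" using X by (simp flip: GH(3))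
  also have "\<dots> = X * A * G + X * H"
    using X A GH(1,2) by (simp add: mult_add_distrib_mat[of _ p n _ n] assoc_mult_mat[of _ p n _ m _ n])
  finally have eq: "X = X * A * G + X * H" .
  have "rank_le (X * A * G + X * H) (mat_rk (X * A) + (n - mat_frk A))"
    using X A GH rank_le_mat_rk(1)[OF R, of "X * A"]
    by (intro rank_le_add[of _ p n] rank_le_mult[of _ p m _ n] rank_le_mult[of X p n H n]) auto
  then show ?thesis using rank_le_mat_rk(2)[OF R] eq by simp
qed

lemma mat_rk_diff_le:
  fixes B :: "'r::comm_ring_1 mat"
  assumes R: "chain_ring TYPE('r)" and "B \<in> carrier_mat n m" "C \<in> carrier_mat n m"
  shows "mat_rk (B - C) \<le> mat_rk B + mat_rk C"
proof -
  have "B - C = B + C * (- 1\<^sub>m m)" using assms by (intro eq_matI) auto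
  moreover have "rank_le (B + C * (- 1\<^sub>m m)) (mat_rk B + mat_rk C)"
    using assms rank_le_mat_rk(1)[OF R]
    by (intro rank_le_add[of _ n m] rank_le_mult[of C n m _ m]) auto
  ultimately show ?thesis using rank_le_mat_rk(2)[OF R] by simp
qed

section \<open>Sum-rank weights\<close>

lemma sum_diag_block_mat_column:
  fixes As :: "'r::comm_ring_1 mat list"
  assumes "i < length As" "b < dim_col (As ! i)"
  shows "(\<Sum>r<sum_list (map dim_row As). diag_block_mat As $$ (r, sum_list (map dim_col (take i As)) + b) * f r)
    = (\<Sum>a<dim_row (As ! i). As ! i $$ (a, b) * f (sum_list (map dim_row (take i As)) + a))"
  using assms
proof (induction As arbitrary: i f)
  case (Cons A As)
  let ?D = "diag_block_mat As"
  let ?N = "sum_list (map dim_row As)" and ?M = "sum_list (map dim_col As)"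
  have split: "(\<Sum>r<dim_row A + k. h r) = (\<Sum>r<dim_row A. h r) + (\<Sum>r<k. h (dim_row A + r))"
    for h :: "nat \<Rightarrow> 'r" and k
    by (induction k) (auto simp: algebra_simps)
  show ?case
  proof (cases i)
    case 0
    then show ?thesis using Cons.prems
      by (simp add: Let_def split dim_diag_block_mat)
  next
    case (Suc j)
    let ?o = "sum_list (map dim_col (take j As))"
    have "drop j As = As ! j # drop (Suc j) As" using Cons.prems Suc by (simp add: Cons_nth_drop_Suc)
    then have "?M = ?o + (dim_col (As ! j) + sum_list (map dim_col (drop (Suc j) As)))"
      by (metis append_take_drop_id list.simps(9) map_append sum_list.Cons sum_list_append)
    then have "?o + b < ?M" using Cons.prems Suc by simp
    then have "(\<Sum>r<sum_list (map dim_row (A # As)). diag_block_mat (A # As) $$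
         (r, sum_list (map dim_col (take i (A # As))) + b) * f r)
      = (\<Sum>r<?N. ?D $$ (r, ?o + b) * f (dim_row A + r))"
      using Suc by (simp add: Let_def split dim_diag_block_mat)
    also have "\<dots> = (\<Sum>a<dim_row (As ! j). As ! j $$ (a, b) *
        f (dim_row A + (sum_list (map dim_row (take j As)) + a)))"
      using Cons.prems Suc by (intro Cons.IH[of j "\<lambda>r. f (dim_row A + r)"]) auto
    finally show ?thesis using Suc by (simp add: add.assoc)
  qed
qed simp

lemma sum_list_take_add_less:
  assumes "i < length ns" "b < ns ! i"
  shows "sum_list (take i ns) + b < sum_list (ns :: nat list)"
proof -
  have "sum_list ns = sum_list (take i ns) + sum_list (drop i ns)"
    by (metis append_take_drop_id sum_list_append)
  also have "drop i ns = ns ! i # drop (Suc i) ns" using assms by (simp add: Cons_nth_drop_Suc)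
  finally show ?thesis using assms by simp
qed

lemma coord_mat_block_vec_mat_S:
  fixes As :: "'r::comm_ring_1 mat list"
  assumes len: "length ns = length Ns" "length As = length ns"
    and blocks: "\<forall>i<length As. As ! i \<in> carrier_mat (ns ! i) (Ns ! i)"
    and x: "dim_vec x = sum_list ns" and i: "i < length ns"
  shows "coord_mat m (block Ns (vec_mat_S x (diag_block_mat As)) i)
    = coord_mat m (block ns x i) * (As ! i)"
proof (rule eq_matI)
  have rows: "map dim_row As = ns" and cols: "map dim_col As = Ns"
    using len blocks by (auto intro!: nth_equalityI)
  have Ai: "dim_row (As ! i) = ns ! i" "dim_col (As ! i) = Ns ! i" using blocks len i by auto
  fix k b assume "k < dim_row (coord_mat m (block ns x i) * (As ! i))"
    and "b < dim_col (coord_mat m (block ns x i) * (As ! i))"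
  then have k: "k < m" and b: "b < Ns ! i" by (auto simp: coord_mat_def Ai)
  have ob: "sum_list (take i Ns) + b < sum_list Ns"
    using sum_list_take_add_less i b len by simp
  have "coord_mat m (block Ns (vec_mat_S x (diag_block_mat As)) i) $$ (k, b)
    = (\<Sum>r<sum_list ns. diag_block_mat As $$ (r, sum_list (take i Ns) + b) * coeff (x $ r) k)"
    using k b ob x by (simp add: coord_mat_def block_def vec_mat_S_def dim_diag_block_mat cols coeff_sum)
  also have "\<dots> = (\<Sum>a<ns ! i. As ! i $$ (a, b) * coeff (x $ (sum_list (take i ns) + a)) k)"
    using sum_diag_block_mat_column[of i As b "\<lambda>r. coeff (x $ r) k"] i b len Ai
    by (simp add: rows cols flip: take_map)
  also have "\<dots> = (coord_mat m (block ns x i) * (As ! i)) $$ (k, b)"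
    using k b by (simp add: coord_mat_def block_def scalar_prod_def Ai atLeast0LessThan mult.commute)
  finally show "coord_mat m (block Ns (vec_mat_S x (diag_block_mat As)) i) $$ (k, b)
    = (coord_mat m (block ns x i) * (As ! i)) $$ (k, b)" .
qed (use blocks len i in \<open>auto simp: coord_mat_def block_def\<close>)

lemma wt_SR_vec_mat_S_ge:
  fixes As :: "'r::comm_ring_1 mat list"
  assumes R: "chain_ring TYPE('r)"
    and len: "length ns = length Ns" "length As = length ns"
    and blocks: "\<forall>i<length As. As ! i \<in> carrier_mat (ns ! i) (Ns ! i)"
    and x: "dim_vec x = sum_list ns"
  shows "wt_SR m ns x \<le> wt_SR m Ns (vec_mat_S x (diag_block_mat As))
    + (sum_list ns - mat_frk (diag_block_mat As))"
proof -
  let ?A = "diag_block_mat As" and ?l = "length ns"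
  have frk: "mat_frk (As ! i) \<le> ns ! i" if "i < ?l" for i
  proof -
    have "As ! i \<in> carrier_mat (ns ! i) (Ns ! i)" using blocks len that by simp
    moreover obtain d where "snf_diag (As ! i) d" "mat_frk (As ! i) =
      card {a. a < min (dim_row (As ! i)) (dim_col (As ! i)) \<and> d a dvd 1}"
      using mat_frk_snf_diag[OF R] .
    moreover have "card {a. a < min (dim_row (As ! i)) (dim_col (As ! i)) \<and> d a dvd 1} \<le> card {..<dim_row (As ! i)}"
      by (intro card_mono) auto
    ultimately show ?thesis by simp
  qed
  have "wt_SR m ns x \<le> (\<Sum>i<?l. vec_rk m (block Ns (vec_mat_S x ?A) i) + (ns ! i - mat_frk (As ! i)))"
    unfolding wt_SR_def
  proof (rule sum_mono)
    fix i assume "i \<in> {..<?l}"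
    then have i: "i < ?l" by simp
    have "coord_mat m (block ns x i) \<in> carrier_mat m (ns ! i)" by (simp add: coord_mat_def block_def)
    then show "vec_rk m (block ns x i) \<le> vec_rk m (block Ns (vec_mat_S x ?A) i) + (ns ! i - mat_frk (As ! i))"
      unfolding vec_rk_def coord_mat_block_vec_mat_S[OF len blocks x i]
      using blocks len i by (intro mat_rk_mult_ge[OF R]) auto
  qed
  also have "\<dots> = wt_SR m Ns (vec_mat_S x ?A) + (\<Sum>i<?l. ns ! i - mat_frk (As ! i))"
    by (simp add: wt_SR_def sum.distrib len(1))
  also have "(\<Sum>i<?l. ns ! i - mat_frk (As ! i)) = (\<Sum>i<?l. ns ! i) - (\<Sum>i<?l. mat_frk (As ! i))"
    using frk by (intro sum_subtractf_nat) auto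
  also have "\<dots> = sum_list ns - (\<Sum>A\<leftarrow>As. mat_frk A)"
    by (simp add: sum_list_sum_nth len atLeast0LessThan)
  also have "\<dots> \<le> sum_list ns - mat_frk ?A" using mat_frk_diag_block_mat[OF R] by (intro diff_le_mono2)
  finally show ?thesis by simp
qed

lemma wt_SR_diff_le:
  fixes u v :: "'r::comm_ring_1 poly vec"
  assumes R: "chain_ring TYPE('r)" and "dim_vec u = sum_list ns" "dim_vec v = sum_list ns"
  shows "wt_SR m ns (u - v) \<le> wt_SR m ns u + wt_SR m ns v"
  unfolding wt_SR_def sum.distrib[symmetric]
proof (rule sum_mono)
  fix i assume "i \<in> {..<length ns}"
  then have "coord_mat m (block ns (u - v) i) = coord_mat m (block ns u i) - coord_mat m (block ns v i)"
    using sum_list_take_add_less[of i ns] assms(2,3)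
    by (intro eq_matI) (auto simp: coord_mat_def block_def)
  then show "vec_rk m (block ns (u - v) i) \<le> vec_rk m (block ns u i) + vec_rk m (block ns v i)"
    unfolding vec_rk_def
    using mat_rk_diff_le[OF R, of "coord_mat m (block ns u i)" m "ns ! i" "coord_mat m (block ns v i)"]
    by (simp add: coord_mat_def block_def)
qed

lemma vec_mat_S_diff:
  assumes "dim_vec c = dim_vec c'"
  shows "vec_mat_S (c - c') A = vec_mat_S c A - vec_mat_S c' A"
  using assms by (intro eq_vecI) (auto simp: vec_mat_S_def smult_diff_right sum_subtractf)

theorem theorem7:
  fixes h :: "'r::comm_ring_1 poly" and m :: nat
    and ns Ns :: "nat list" and As :: "'r mat list"
    and C :: "'r poly vec set" and t :: nat
  assumes R: "chain_ring TYPE('r)"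
    and h: "monic_irred_mod_max h m"
    and len: "length ns = length Ns" "length As = length ns"
    and pos: "\<forall>i<length ns. ns ! i > 0 \<and> Ns ! i > 0"
    and blocks: "\<forall>i<length As. As ! i \<in> carrier_mat (ns ! i) (Ns ! i)"
    and code: "C \<subseteq> S_vecs m (sum_list ns)" "C \<noteq> {}"
    and dist: "enat (2 * t + (sum_list ns - mat_frk (diag_block_mat As)) + 1)
                 \<le> d_SR m ns C"
  shows "\<exists>D. (\<forall>y \<in> S_vecs m (sum_list Ns). D y \<in> C) \<and>
             (\<forall>c \<in> C. \<forall>e \<in> S_vecs m (sum_list Ns). wt_SR m Ns e \<le> t \<longrightarrow>
                D (vec_mat_S c (diag_block_mat As) + e) = c)"
proof -
  let ?A = "diag_block_mat As" and ?E = "{e \<in> S_vecs m (sum_list Ns). wt_SR m Ns e \<le> t}"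
  have cols: "map dim_col As = Ns" using len blocks by (auto intro!: nth_equalityI)
  have dimA: "dim_vec (vec_mat_S c ?A) = sum_list Ns" for c :: "'r poly vec"
    by (simp add: vec_mat_S_def dim_diag_block_mat cols)
  have unique: "c = c'"
    if c: "c \<in> C" "c' \<in> C" and e: "e \<in> ?E" "e' \<in> ?E"
      and eq: "vec_mat_S c ?A + e = vec_mat_S c' ?A + e'" for c c' e e'
  proof (rule ccontr)
    assume ne: "c \<noteq> c'"
    have dims: "dim_vec c = sum_list ns" "dim_vec c' = sum_list ns"
      "dim_vec e = sum_list Ns" "dim_vec e' = sum_list Ns"
      using c e code(1) unfolding S_vecs_def by auto
    have "vec_mat_S (c - c') ?A = e' - e"
    proof (rule eq_vecI)
      fix j assume "j < dim_vec (e' - e)"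
      then have "j < sum_list Ns" using dims by simp
      moreover from this have "vec_mat_S c ?A $ j + e $ j = vec_mat_S c' ?A $ j + e' $ j"
        using arg_cong[OF eq, of "\<lambda>v. v $ j"] dims dimA by simp
      ultimately show "vec_mat_S (c - c') ?A $ j = (e' - e) $ j"
        using dims dimA by (simp add: vec_mat_S_diff algebra_simps)
    qed (use dims dimA in simp)
    then have "wt_SR m ns (c - c') \<le> wt_SR m Ns (e' - e) + (sum_list ns - mat_frk ?A)"
      using wt_SR_vec_mat_S_ge[OF R len blocks, of "c - c'" m] dims by simp
    moreover have "wt_SR m Ns (e' - e) \<le> t + t"
      using wt_SR_diff_le[OF R, of e' Ns e m] dims e by simp
    moreover have "d_SR m ns C \<le> enat (wt_SR m ns (c - c'))"
      unfolding d_SR_def using c ne by (intro INF_lower2[of "(c, c')"]) auto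
    with dist have "2 * t + (sum_list ns - mat_frk ?A) + 1 \<le> wt_SR m ns (c - c')"
      using order_trans enat_ord_simps(1) by blast
    ultimately show False by simp
  qed
  have "\<forall>y. \<exists>x. x \<in> C \<and> (\<forall>c\<in>C. \<forall>e\<in>?E. y = vec_mat_S c ?A + e \<longrightarrow> x = c)"
  proof
    fix y
    show "\<exists>x. x \<in> C \<and> (\<forall>c\<in>C. \<forall>e\<in>?E. y = vec_mat_S c ?A + e \<longrightarrow> x = c)"
    proof (cases "\<exists>c\<in>C. \<exists>e\<in>?E. y = vec_mat_S c ?A + e")
      case True
      then obtain c e where "c \<in> C" "e \<in> ?E" "y = vec_mat_S c ?A + e" by blast
      then show ?thesis using unique by (intro exI[of _ c]) auto
    qed (use code(2) in blast)
  qed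
  from choice[OF this] obtain D where
    "\<forall>y. D y \<in> C \<and> (\<forall>c\<in>C. \<forall>e\<in>?E. y = vec_mat_S c ?A + e \<longrightarrow> D y = c)" ..
  then show ?thesis by (intro exI[of _ D]) auto
qed

end
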